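(* Let $X\subseteq\mathcal A^{\mathbb Z}$ be a minimal specular subshift relative to an involution $\theta:\mathcal A\to\mathcal A$ without fixed points. Then the continuous additive rational eigenvalues of $X$ are trivial, i.e. $E(X,S) \cap \mathbb{Q}= \mathbb{Z}$, unless every letter of $\mathcal A$ is odd, in which case $\frac{1}{2}\mathbb{Z} \subseteq E(X,S) \cap \mathbb{Q}$.
   Context: A subshift is a closed set $X\subseteq\mathcal A^{\mathbb Z}$ ($\mathcal A$ a finite alphabet) with $S(X)=X$, $S$ the shift map; it is minimal if every orbit is dense. $\mathcal L(X)$ is the set of finite words occurring in points of $X$; every letter of $\mathcal A$ occurs in $\mathcal L(X)$. $E(X,S)$ is the group of continuous additive eigenvalues: real $\alpha$ for which there is a continuous $g:X\to\mathbb R/\mathbb Z$ with $g(Sx)=g(x)+\alpha\pmod{\mathbb Z}$ for all $x\in X$. For $w\in\mathcal L(X)$, the extension graph $\Gamma_X(w)$ is the bipartite undirected graph with left vertices $\{a_L: a\in\mathcal A,\ aw\in\mathcal L(X)\}$ and right vertices $\{b_R: b\in\mathcal A,\ wb\in\mathcal L(X)\}$ (disjoint copies), with an edge between $a_L$ and $b_R$ iff $awb\in\mathcal L(X)$. Let $\theta:\mathcal A\to\mathcal A$ be an involution ($\theta\circ\theta=\mathrm{id}$) and $G_\theta=\langle a\in\mathcal A\mid a\,\theta(a)=1\rangle$. A word over $\mathcal A$ is reduced if it has no factor $a\theta(a)$, $a\in\mathcal A$. A minimal subshift $X\subseteq\mathcal A^{\mathbb Z}$ is specular relative to $\theta$ if: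 every word of $\mathcal L(X)$ is reduced; $\mathcal L(X)$ is symmetric, i.e. $a_1\cdots a_k\in\mathcal L(X)$ implies $\theta(a_k)\cdots\theta(a_1)\in\mathcal L(X)$; $\Gamma_X(w)$ is a tree for every non-empty $w\in\mathcal L(X)$; and the extension graph $\Gamma_X(\varepsilon)$ of the empty word has exactly two connected components, each of which is a tree. A letter $a\in\mathcal A$ is even if $a_L$ and $a_R$ lie in the same connected component of $\Gamma_X(\varepsilon)$, and odd otherwise. *)

theory Defs
  imports "HOL-Analysis.Analysis" "HOL-Library.Sublist"
begin

section \<open>The topological group of reals modulo the integers\<close>

quotient_type real_mod_int = real / "\<lambda>x y :: real. x - y \<in> \<int>"
  morphisms rep_mod_int to_mod_int
proof (rule equivpI)
  show "reflp (\<lambda>x y :: real. x - y \<in> \<int>)"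
    by (rule reflpI) simp
  show "symp (\<lambda>x y :: real. x - y \<in> \<int>)"
  proof (rule sympI)
    fix x y :: real
    assume "x - y \<in> \<int>"
    then have "- (x - y) \<in> \<int>" by (rule Ints_minus)
    then show "y - x \<in> \<int>" by simp
  qed
  show "transp (\<lambda>x y :: real. x - y \<in> \<int>)"
  proof (rule transpI)
    fix x y z :: real
    assume "x - y \<in> \<int>" "y - z \<in> \<int>"
    then have "(x - y) + (y - z) \<in> \<int>" by (rule Ints_add)
    then show "x - z \<in> \<int>" by simp
  qed
qed

instantiation real_mod_int :: ab_group_add
begin

lift_definition zero_real_mod_int :: real_mod_int is "0 :: real" .

lift_definition plus_real_mod_int :: "real_mod_int \<Rightarrow> real_mod_int \<Rightarrow> real_mod_int"
  is "(+) :: real \<Rightarrow> real \<Rightarrow> real"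
proof -
  fix a b c d :: real
  assume "a - b \<in> \<int>" "c - d \<in> \<int>"
  then have "(a - b) + (c - d) \<in> \<int>" by (rule Ints_add)
  then show "(a + c) - (b + d) \<in> \<int>" by (simp only: add_diff_add)
qed

lift_definition uminus_real_mod_int :: "real_mod_int \<Rightarrow> real_mod_int"
  is "uminus :: real \<Rightarrow> real"
proof -
  fix a b :: real
  assume "a - b \<in> \<int>"
  then have "- (a - b) \<in> \<int>" by (rule Ints_minus)
  then show "- a - - b \<in> \<int>" by simp
qed

lift_definition minus_real_mod_int :: "real_mod_int \<Rightarrow> real_mod_int \<Rightarrow> real_mod_int"
  is "(-) :: real \<Rightarrow> real \<Rightarrow> real"
proof -
  fix a b c d :: real
  assume "a - b \<in> \<int>" "c - d \<in> \<int>"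
  then have "(a - b) - (c - d) \<in> \<int>" by (rule Ints_diff)
  moreover have "(a - b) - (c - d) = (a - c) - (b - d)" by linarith
  ultimately show "(a - c) - (b - d) \<in> \<int>" by simp
qed

instance
proof
  fix a b c :: real_mod_int
  show "a + b + c = a + (b + c)" by transfer (simp add: add.assoc)
  show "a + b = b + a" by transfer (simp add: add.commute)
  show "0 + a = a" by transfer simp
  show "- a + a = 0" by transfer simp
  show "a - b = a + - b" by transfer simp
qed

end

instantiation real_mod_int :: topological_space
begin

definition open_real_mod_int :: "real_mod_int set \<Rightarrow> bool" where
  "open_real_mod_int U \<longleftrightarrow> open (to_mod_int -` U)"

instance
  by standard (auto simp: open_real_mod_int_def vimage_Union)

end

section \<open>Subshifts and their languages\<close>

text \<open>The alphabet is a finite type with the discrete topology; \<^typ>\<open>int \<Rightarrow> 'a\<close> then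
  carries the product topology.\<close>

definition shift :: "(int \<Rightarrow> 'a) \<Rightarrow> int \<Rightarrow> 'a" where
  "shift x = (\<lambda>i. x (i + 1))"

definition subshift :: "(int \<Rightarrow> 'a::{finite,discrete_topology}) set \<Rightarrow> bool" where
  "subshift X \<longleftrightarrow> closed X \<and> shift ` X = X"

definition shift_orbit :: "(int \<Rightarrow> 'a) \<Rightarrow> (int \<Rightarrow> 'a) set" where
  "shift_orbit x = range (\<lambda>n i. x (i + n))"

definition minimal_subshift :: "(int \<Rightarrow> 'a::{finite,discrete_topology}) set \<Rightarrow> bool" where
  "minimal_subshift X \<longleftrightarrow> subshift X \<and> (\<forall>x\<in>X. X \<subseteq> closure (shift_orbit x))"

definition language :: "(int \<Rightarrow> 'a) set \<Rightarrow> 'a list set" where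
  "language X = {map (\<lambda>k. x (i + int k)) [0..<n] | x i n. x \<in> X}"

definition eigenvalues :: "(int \<Rightarrow> 'a::{finite,discrete_topology}) set \<Rightarrow> real set" where
  "eigenvalues X = {\<alpha>. \<exists>g :: (int \<Rightarrow> 'a) \<Rightarrow> real_mod_int. continuous_on X g \<and>
     (\<forall>x\<in>X. g (shift x) = g x + to_mod_int \<alpha>)}"

section \<open>Undirected graphs\<close>

text \<open>A simple graph is a pair of a vertex set and a set of two-element edges. The predicate
  \<open>tree\<close> of the AFP entry Graph\_Theory only forbids directed cycles, and in a symmetric digraph
  every edge is such a cycle of length two, so it does not express undirected trees.\<close>

type_synonym 'v ugraph = "'v set \<times> 'v set set"

definition walk :: "'v ugraph \<Rightarrow> 'v list \<Rightarrow> bool" where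
  "walk G p \<longleftrightarrow> p \<noteq> [] \<and> set p \<subseteq> fst G \<and> successively (\<lambda>u v. {u, v} \<in> snd G) p"

definition joined :: "'v ugraph \<Rightarrow> 'v \<Rightarrow> 'v \<Rightarrow> bool" where
  "joined G u v \<longleftrightarrow> (\<exists>p. walk G p \<and> hd p = u \<and> last p = v)"

definition cycle :: "'v ugraph \<Rightarrow> 'v list \<Rightarrow> bool" where
  "cycle G p \<longleftrightarrow> walk G p \<and> distinct p \<and> length p \<ge> 3 \<and> {last p, hd p} \<in> snd G"

definition tree :: "'v ugraph \<Rightarrow> bool" where
  "tree G \<longleftrightarrow> fst G \<noteq> {} \<and> (\<forall>u\<in>fst G. \<forall>v\<in>fst G. joined G u v) \<and> (\<nexists>p. cycle G p)"

definition components :: "'v ugraph \<Rightarrow> 'v set set" where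
  "components G = {{v \<in> fst G. joined G u v} | u. u \<in> fst G}"

definition induced :: "'v ugraph \<Rightarrow> 'v set \<Rightarrow> 'v ugraph" where
  "induced G C = (C, {e \<in> snd G. e \<subseteq> C})"

section \<open>Specular subshifts\<close>

text \<open>\<^term>\<open>Inl a\<close> is the left copy of the letter \<open>a\<close>, and \<^term>\<open>Inr a\<close> its right copy.\<close>

definition extension_graph :: "(int \<Rightarrow> 'a) set \<Rightarrow> 'a list \<Rightarrow> ('a + 'a) ugraph" where
  "extension_graph X w =
     ({Inl a | a. a # w \<in> language X} \<union> {Inr b | b. w @ [b] \<in> language X},
      {{Inl a, Inr b} | a b. a # w @ [b] \<in> language X})"

definition reduced :: "('a \<Rightarrow> 'a) \<Rightarrow> 'a list \<Rightarrow> bool" where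
  "reduced \<theta> w \<longleftrightarrow> (\<nexists>a. sublist [a, \<theta> a] w)"

definition specular :: "('a \<Rightarrow> 'a) \<Rightarrow> (int \<Rightarrow> 'a::{finite,discrete_topology}) set \<Rightarrow> bool" where
  "specular \<theta> X \<longleftrightarrow>
     (\<forall>w\<in>language X. reduced \<theta> w) \<and>
     (\<forall>w\<in>language X. rev (map \<theta> w) \<in> language X) \<and>
     (\<forall>w\<in>language X. w \<noteq> [] \<longrightarrow> tree (extension_graph X w)) \<and>
     card (components (extension_graph X [])) = 2 \<and>
     (\<forall>C\<in>components (extension_graph X []). tree (induced (extension_graph X []) C))"

definition even_letter :: "(int \<Rightarrow> 'a) set \<Rightarrow> 'a \<Rightarrow> bool" where
  "even_letter X a \<longleftrightarrow> (\<exists>C\<in>components (extension_graph X []). Inl a \<in> C \<and> Inr a \<in> C)"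

abbreviation odd_letter :: "(int \<Rightarrow> 'a) set \<Rightarrow> 'a \<Rightarrow> bool" where
  "odd_letter X a \<equiv> \<not> even_letter X a"

end

theory Submission
  imports Defs
begin

text \<open>Let \<open>g\<close> be a continuous eigenfunction for a rational \<open>\<alpha>\<close>. Along one orbit \<open>g\<close> takes finitely
  many values, since the multiples of \<open>\<alpha>\<close> are finite in number modulo the integers; orbits being
  dense, \<open>g\<close> takes finitely many values altogether, and by compactness it depends only on a finite
  window of coordinates. Reading it off that window gives a potential on the words of some
  positive length \<open>n\<close>: a function \<open>h\<close> that grows by \<open>\<alpha>\<close> whenever the word slides by one letter,
  that is, along every edge of the Rauzy graph of order \<open>n\<close>
  (\<open>eigenfunction_imp_word_potential\<close>).

  The extension graph of a non-empty word \<open>w\<close> is connected. The potential on words of length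
  \<open>Suc (length w)\<close> gives a function on its vertices, \<open>h (a # w) + \<alpha>\<close> at a left vertex and
  \<open>h (w @ [b])\<close> at a right vertex, which agrees at the ends of each edge and is therefore constant.
  Its value is a potential at \<open>w\<close>, so potentials descend from length \<open>n + 1\<close> to length \<open>n\<close> as long
  as \<open>n \<ge> 1\<close> (\<open>word_potential_descend\<close>). At length one the same function lives on the extension
  graph of the empty word and is constant on its components only. An even letter \<open>a\<close> has both
  copies in one component, whence \<open>h [a] + \<alpha> = h [a]\<close> and \<open>\<alpha>\<close> is an integer.
  In other words, the signed lengths of loops are the same in every Rauzy graph of positive order as
  in the graph with one vertex for each component of the extension graph of the empty word and, for
  each letter \<open>a\<close>, an edge from the component of the right copy of \<open>a\<close> to that of its left copy; an
  even letter is a loop of length one there.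

  If instead all letters are odd, that two-vertex graph is bipartite: the component that contains
  the left copy of \<open>x 0\<close> alternates along the orbit of \<open>x\<close> and gives an eigenfunction for
  every half-integer.\<close>

section \<open>Words of a shift-invariant set\<close>

lemma translate_in_subshift:
  assumes "subshift X" "x \<in> X"
  shows "(\<lambda>i. x (i + n)) \<in> X"
proof -
  have inv: "shift ` X = X" using assms(1) by (simp add: subshift_def)
  show ?thesis
  proof (induction n rule: int_induct[where k = 0])
    case base
    show ?case using assms(2) by simp
  next
    case (step1 m)
    have "shift (\<lambda>i. x (i + m)) \<in> X" using step1(2) inv by blast
    then show ?case by (simp add: shift_def algebra_simps)
  next
    case (step2 m)
    then obtain y where y: "y \<in> X" "(\<lambda>i. x (i + m)) = shift y" using inv by blast
    have "y i = x (i + (m - 1))" for i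
      using fun_cong[OF y(2), of "i - 1"] by (simp add: shift_def algebra_simps)
    then have "y = (\<lambda>i. x (i + (m - 1)))" by blast
    then show ?case using y(1) by simp
  qed
qed

lemma languageE:
  assumes "w \<in> language X"
  obtains x i where "x \<in> X" "w = map (\<lambda>k. x (i + int k)) [0..<length w]"
  using assms by (force simp: language_def)

lemma languageI:
  assumes "x \<in> X" "w = map (\<lambda>k. x (i + int k)) [0..<n]"
  shows "w \<in> language X"
  using assms unfolding language_def by blast

lemma language_tl:
  assumes "a # w \<in> language X"
  shows "w \<in> language X"
proof -
  obtain x i where x: "x \<in> X" "a # w = map (\<lambda>k. x (i + int k)) [0..<length (a # w)]"
    using languageE[OF assms] .
  have "w = tl (a # w)" by simp
  also have "\<dots> = map (\<lambda>k. x ((i + 1) + int k)) [0..<length w]"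
    by (subst x(2)) (rule nth_equalityI, simp_all add: nth_tl algebra_simps del: upt_Suc)
  finally show ?thesis by (rule languageI[OF x(1)])
qed

lemma language_butlast:
  assumes "w @ [b] \<in> language X"
  shows "w \<in> language X"
proof -
  obtain x i where x: "x \<in> X" "w @ [b] = map (\<lambda>k. x (i + int k)) [0..<length (w @ [b])]"
    using languageE[OF assms] .
  then have "w = map (\<lambda>k. x (i + int k)) [0..<length w]" by simp
  then show ?thesis by (rule languageI[OF x(1)])
qed

lemma language_right_extendable:
  assumes "w \<in> language X"
  obtains b where "w @ [b] \<in> language X"
proof -
  obtain x i where x: "x \<in> X" "w = map (\<lambda>k. x (i + int k)) [0..<length w]"
    using languageE[OF assms] .
  then have "w @ [x (i + int (length w))] = map (\<lambda>k. x (i + int k)) [0..<Suc (length w)]" by simp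
  then show ?thesis using that languageI[OF x(1)] by blast
qed

section \<open>Functions constant along the edges of a graph\<close>

lemma joined_imp_eq:
  assumes "joined G u v"
    and edge: "\<And>u v. {u, v} \<in> snd G \<Longrightarrow> f u = f v"
  shows "f u = f v"
proof -
  obtain p where p: "p \<noteq> []" "successively (\<lambda>u v. {u, v} \<in> snd G) p" "hd p = u" "last p = v"
    using assms(1) by (auto simp: joined_def walk_def)
  from p(1,2) have "f (hd p) = f (last p)"
  proof (induction p rule: induct_list012)
    case (3 x y zs)
    then show ?case using edge[of x y] by simp
  qed simp_all
  then show ?thesis using p by simp
qed

lemma joined_refl: "u \<in> fst G \<Longrightarrow> joined G u u"
  unfolding joined_def walk_def by (intro exI[of _ "[u]"]) simp

lemma joined_step:
  assumes "joined G u v" "{v, w} \<in> snd G" "w \<in> fst G"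
  shows "joined G u w"
proof -
  obtain p where "walk G p" "hd p = u" "last p = v" using assms(1) by (auto simp: joined_def)
  then have "walk G (p @ [w]) \<and> hd (p @ [w]) = u \<and> last (p @ [w]) = w"
    using assms(2,3) by (auto simp: walk_def successively_append_iff)
  then show ?thesis unfolding joined_def by blast
qed

lemma component_edge:
  assumes "C \<in> components G" "{u, v} \<in> snd G" "u \<in> fst G" "v \<in> fst G"
  shows "u \<in> C \<longleftrightarrow> v \<in> C"
proof -
  have "{v, u} \<in> snd G" using assms(2) by (simp add: insert_commute)
  then show ?thesis using assms joined_step[of G _ u v] joined_step[of G _ v u]
    by (auto simp: components_def)
qed

lemma component_cover:
  assumes "u \<in> fst G"
  obtains C where "C \<in> components G" "u \<in> C"
proof -
  have "u \<in> {v \<in> fst G. joined G u v}" using assms joined_refl by simp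
  then show ?thesis using that assms unfolding components_def by blast
qed

section \<open>Potentials on words of a given length\<close>

text \<open>For \<open>n \<ge> 1\<close> the words of length \<open>Suc n\<close> are the edges of the Rauzy graph of order \<open>n\<close>, going
  from \<open>butlast v\<close> to \<open>tl v\<close>.\<close>

definition word_potential ::
    "(int \<Rightarrow> 'a) set \<Rightarrow> 'b::ab_group_add \<Rightarrow> nat \<Rightarrow> ('a list \<Rightarrow> 'b) \<Rightarrow> bool" where
  "word_potential X c n h \<longleftrightarrow>
     (\<forall>v\<in>language X. length v = Suc n \<longrightarrow> h (tl v) = h (butlast v) + c)"

fun extension_value :: "'b::ab_group_add \<Rightarrow> ('a list \<Rightarrow> 'b) \<Rightarrow> 'a list \<Rightarrow> 'a + 'a \<Rightarrow> 'b" where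
  "extension_value c h w (Inl a) = h (a # w) + c"
| "extension_value c h w (Inr b) = h (w @ [b])"

text \<open>An edge of the extension graph of \<open>w\<close> is a word \<open>a # w @ [b]\<close>, and sliding from
  \<open>a # w\<close> to \<open>w @ [b]\<close> costs \<open>c\<close>, which the value at the left vertex already includes.\<close>

lemma extension_value_joined:
  assumes "word_potential X c (Suc (length w)) h" "joined (extension_graph X w) u v"
  shows "extension_value c h w u = extension_value c h w v"
proof (rule joined_imp_eq[OF assms(2)])
  fix u v
  assume "{u, v} \<in> snd (extension_graph X w)"
  then obtain a b where ab: "{u, v} = {Inl a, Inr b}" "a # w @ [b] \<in> language X"
    by (auto simp: extension_graph_def)
  then have "h (w @ [b]) = h (a # w) + c"
    using assms(1) unfolding word_potential_def by (force simp: butlast_append)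
  then show "extension_value c h w u = extension_value c h w v"
    using ab(1) by (auto simp: doubleton_eq_iff)
qed

text \<open>The new potential at \<open>w\<close> is the constant value on the extension graph of \<open>w\<close>, read at any
  right vertex. For a word \<open>a # u @ [b]\<close> it equals \<open>h (a # u @ [b])\<close> at \<open>a # u\<close>, of which \<open>b\<close> is a
  right vertex, and \<open>h (a # u @ [b]) + c\<close> at \<open>u @ [b]\<close>, of which \<open>a\<close> is a left vertex.\<close>

lemma word_potential_descend:
  assumes conn: "\<And>w u v. w \<in> language X \<Longrightarrow> length w = n \<Longrightarrow> u \<in> fst (extension_graph X w) \<Longrightarrow>
      v \<in> fst (extension_graph X w) \<Longrightarrow> joined (extension_graph X w) u v"
    and pot: "word_potential X c (Suc n) h" and "n > 0"
  shows "\<exists>h'. word_potential X c n h'"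
proof -
  define h' where "h' w = h (w @ [SOME b. w @ [b] \<in> language X])" for w
  have h': "h' w = extension_value c h w u"
    if "w \<in> language X" "length w = n" "u \<in> fst (extension_graph X w)" for w u
  proof -
    define s where "s = (SOME b. w @ [b] \<in> language X)"
    have "w @ [s] \<in> language X"
      unfolding s_def by (rule language_right_extendable[OF that(1)]) (rule someI)
    then have "Inr s \<in> fst (extension_graph X w)" by (simp add: extension_graph_def)
    then have "joined (extension_graph X w) (Inr s) u" using conn that by blast
    from extension_value_joined[OF _ this, of c h] show ?thesis
      using pot that(2) by (simp add: h'_def s_def)
  qed
  have "h' (tl v) = h' (butlast v) + c" if v: "v \<in> language X" "length v = Suc n" for v
  proof -
    obtain a u b where aub: "v = a # u @ [b]"
      using v(2) \<open>n > 0\<close> by (cases v; cases "tl v" rule: rev_cases) auto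
    have L: "u @ [b] \<in> language X" "a # u \<in> language X"
      using language_tl[of a "u @ [b]" X] language_butlast[of "a # u" b X] v(1) aub by auto
    have "h' (u @ [b]) = extension_value c h (u @ [b]) (Inl a)"
      by (rule h') (use L v aub in \<open>auto simp: extension_graph_def\<close>)
    moreover have "h' (a # u) = extension_value c h (a # u) (Inr b)"
      by (rule h') (use L v aub in \<open>auto simp: extension_graph_def\<close>)
    ultimately show ?thesis using aub by (simp add: butlast_append)
  qed
  then show ?thesis unfolding word_potential_def by blast
qed

lemma word_potential_length_one:
  assumes conn: "\<And>w u v. w \<in> language X \<Longrightarrow> w \<noteq> [] \<Longrightarrow> u \<in> fst (extension_graph X w) \<Longrightarrow>
      v \<in> fst (extension_graph X w) \<Longrightarrow> joined (extension_graph X w) u v"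
    and "word_potential X c (Suc n) h"
  shows "\<exists>h'. word_potential X c 1 h'"
  using assms(2)
proof (induction n arbitrary: h)
  case (Suc n)
  have "\<exists>h'. word_potential X c (Suc n) h'"
    by (rule word_potential_descend[OF _ Suc.prems]) (auto intro: conn)
  then show ?case using Suc.IH by blast
qed auto

lemma even_letter_word_potential_trivial:
  assumes "even_letter X a" "word_potential X c 1 h"
  shows "c = 0"
proof -
  let ?G = "extension_graph X []"
  obtain u where "joined ?G u (Inl a)" "joined ?G u (Inr a)"
    using assms(1) by (auto simp: even_letter_def components_def)
  moreover have "word_potential X c (Suc (length [])) h" using assms(2) by simp
  ultimately have "extension_value c h [] (Inl a) = extension_value c h [] (Inr a)"
    by (metis extension_value_joined)
  then show ?thesis by simp
qed

section \<open>Locally constant functions on a subshift\<close>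

lemma open_sequence_contains_window:
  fixes U :: "(int \<Rightarrow> 'a::topological_space) set"
  assumes "open U" "x \<in> U"
  shows "\<exists>N::nat. \<forall>y. (\<forall>i. \<bar>i\<bar> \<le> int N \<longrightarrow> y i = x i) \<longrightarrow> y \<in> U"
proof -
  have "openin (product_topology (\<lambda>i. euclidean) UNIV) U"
    using assms(1) by (simp add: open_fun_def)
  from product_topology_open_contains_basis[OF this assms(2)] obtain B
    where B: "x \<in> (\<Pi>\<^sub>E i\<in>UNIV. B i)" "finite {i. B i \<noteq> UNIV}" "(\<Pi>\<^sub>E i\<in>UNIV. B i) \<subseteq> U"
    by auto
  define N where "N = Max (insert 0 ((\<lambda>i. nat \<bar>i\<bar>) ` {i. B i \<noteq> UNIV}))"
  have N: "\<bar>i\<bar> \<le> int N" if "B i \<noteq> UNIV" for i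
  proof -
    have "nat \<bar>i\<bar> \<le> N" unfolding N_def using B(2) that by (intro Max_ge) auto
    then show ?thesis by linarith
  qed
  have "y \<in> U" if y: "\<forall>i. \<bar>i\<bar> \<le> int N \<longrightarrow> y i = x i" for y
  proof -
    have "y i \<in> B i" for i
      using B(1) N[of i] y by (cases "B i = UNIV") (auto simp: PiE_iff)
    then show ?thesis using B(3) by (auto simp: PiE_iff)
  qed
  then show ?thesis by blast
qed

lemma compact_sequences_finite_alphabet:
  "compact (UNIV :: (int \<Rightarrow> 'a::{finite,topological_space}) set)"
proof -
  have "compact_space (product_topology (\<lambda>i::int. euclidean :: 'a topology) UNIV)"
    unfolding compact_space_product_topology by (simp add: compact_space_def finite_imp_compact)
  then have "compactin euclidean (UNIV :: (int \<Rightarrow> 'a) set)"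
    by (simp only: compact_space_def euclidean_product_topology topspace_euclidean)
  then show ?thesis by simp
qed

text \<open>With finitely many values in a T1 space the fibres are open, so each point has a window that
  determines the value; a finite subcover bounds the window uniformly.\<close>

lemma finite_valued_depends_on_window:
  fixes X :: "(int \<Rightarrow> 'a::{finite,discrete_topology}) set"
    and g :: "(int \<Rightarrow> 'a) \<Rightarrow> 'b::t1_space"
  assumes "closed X" "continuous_on X g" "finite (g ` X)"
  obtains N :: nat where
    "\<And>x y. x \<in> X \<Longrightarrow> y \<in> X \<Longrightarrow> (\<And>i. \<bar>i\<bar> \<le> int N \<Longrightarrow> x i = y i) \<Longrightarrow> g x = g y"
proof -
  have "compact X"
    using compact_Int_closed[OF compact_sequences_finite_alphabet assms(1)] by simp
  define W where "W x n = {y. \<forall>i. \<bar>i\<bar> \<le> int n \<longrightarrow> y i = x i}" for x :: "int \<Rightarrow> 'a" and n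
  have window: "\<exists>n. \<forall>y\<in>X \<inter> W x n. g y = g x" if "x \<in> X" for x
  proof -
    have "open (- (g ` X - {g x}))" using assms(3) by (intro open_Compl finite_imp_closed) simp
    then obtain A where A: "open A" "A \<inter> X = g -` (- (g ` X - {g x})) \<inter> X"
      using assms(2) unfolding continuous_on_open_invariant by blast
    have A_iff: "y \<in> A \<longleftrightarrow> g y = g x" if "y \<in> X" for y
      proof -
      have "y \<in> A \<inter> X \<longleftrightarrow> y \<in> g -` (- (g ` X - {g x})) \<inter> X" by (simp only: A(2))
      then show ?thesis using that by simp
    qed
    then have "x \<in> A" using that by simp
    from open_sequence_contains_window[OF A(1) this]
    obtain n where n: "\<forall>y. (\<forall>i. \<bar>i\<bar> \<le> int n \<longrightarrow> y i = x i) \<longrightarrow> y \<in> A" ..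
    have "g y = g x" if "y \<in> X \<inter> W x n" for y
    proof -
      have "y \<in> A" using n that by (simp add: W_def)
      then show ?thesis using A_iff that by simp
    qed
    then show ?thesis by blast
  qed
  then obtain r where r: "\<And>x y. x \<in> X \<Longrightarrow> y \<in> X \<inter> W x (r x) \<Longrightarrow> g y = g x" by metis
  have W_open: "open (W x n)" for x :: "int \<Rightarrow> 'a" and n
  proof -
    have "W x n = (\<Inter>i\<in>{- int n..int n}. (\<lambda>y. y i) -` {x i})"
      by (auto simp: W_def abs_le_iff)
    moreover have "open ((\<lambda>y :: int \<Rightarrow> 'a. y i) -` {x i})" for i
      by (rule open_vimage) (auto intro: open_discrete continuous_on_product_coordinates)
    ultimately show ?thesis by (simp add: open_INT)
  qed
  have "X \<subseteq> (\<Union>x\<in>X. W x (r x))" by (auto simp: W_def)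
  then obtain D where D: "D \<subseteq> X" "finite D" "X \<subseteq> (\<Union>x\<in>D. W x (r x))"
    using compactE_image[OF \<open>compact X\<close>, of X "\<lambda>x. W x (r x)"] W_open by metis
  obtain N where N: "\<And>d. d \<in> D \<Longrightarrow> r d \<le> N"
    using D(2) finite_nat_set_iff_bounded_le[of "r ` D"] by auto
  have "g x = g y" if xy: "x \<in> X" "y \<in> X" "\<And>i. \<bar>i\<bar> \<le> int N \<Longrightarrow> x i = y i" for x y
  proof -
    obtain d where d: "d \<in> D" "x \<in> W d (r d)" using D(3) xy(1) by blast
    then have "y \<in> W d (r d)" using N[OF d(1)] xy(3) by (fastforce simp: W_def)
    then show ?thesis using r d D(1) xy(1,2) by (metis IntI subsetD)
  qed
  then show ?thesis using that by blast
qed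

section \<open>From rational eigenfunctions to potentials\<close>

lemma to_mod_int_eq_iff: "to_mod_int x = to_mod_int y \<longleftrightarrow> x - y \<in> \<int>"
  by (rule real_mod_int.abs_eq_iff)

lemma to_mod_int_add: "to_mod_int x + to_mod_int y = to_mod_int (x + y)"
  by (rule plus_real_mod_int.abs_eq)

lemma to_mod_int_eq_0_iff: "to_mod_int x = 0 \<longleftrightarrow> x \<in> \<int>"
  by (simp add: zero_real_mod_int_def to_mod_int_eq_iff)

instance real_mod_int :: t1_space
proof
  fix x y :: real_mod_int
  assume "x \<noteq> y"
  obtain r where r: "y = to_mod_int r" by (induction y rule: real_mod_int.abs_induct) blast
  have "closed ((\<lambda>s. s - r) -` \<int>)"
    by (rule closed_vimage) (auto intro!: continuous_intros)
  moreover have "to_mod_int -` (- {y}) = - ((\<lambda>s. s - r) -` \<int>)"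
    by (auto simp: r to_mod_int_eq_iff)
  ultimately have "open (- {y})" by (simp add: open_real_mod_int_def open_Compl)
  then show "\<exists>U. open U \<and> x \<in> U \<and> y \<notin> U" using \<open>x \<noteq> y\<close> by blast
qed

lemma finite_int_multiples_mod_int:
  assumes "\<alpha> \<in> \<rat>"
  shows "finite (range (\<lambda>n::int. to_mod_int (of_int n * \<alpha>)))"
proof -
  obtain p q :: int where pq: "q > 0" "\<alpha> = of_int p / of_int q"
    using assms by (metis Rats_cases' )
  have "to_mod_int (of_int n * \<alpha>) \<in> (\<lambda>k. to_mod_int (of_int k * \<alpha>)) ` {0..<q}" for n
  proof
    have "(of_int n :: real) = of_int q * of_int (n div q) + of_int (n mod q)"
      by (metis mult_div_mod_eq of_int_add of_int_mult)
    then have "of_int n * \<alpha> - of_int (n mod q) * \<alpha> = of_int (n div q * p)"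
      using pq by (simp add: field_simps)
    then show "to_mod_int (of_int n * \<alpha>) = to_mod_int (of_int (n mod q) * \<alpha>)"
      by (simp add: to_mod_int_eq_iff)
    show "n mod q \<in> {0..<q}" using pq(1) by simp
  qed
  then show ?thesis by (meson finite_atLeastLessThan_int finite_imageI finite_subset image_subsetI)
qed

lemma eigenfunction_translate:
  assumes "subshift X" and eig: "\<And>x. x \<in> X \<Longrightarrow> g (shift x) = g x + to_mod_int \<alpha>" and "x \<in> X"
  shows "g (\<lambda>i. x (i + n)) = g x + to_mod_int (of_int n * \<alpha>)"
proof -
  have step: "g (\<lambda>i. x (i + (m + 1))) = g (\<lambda>i. x (i + m)) + to_mod_int \<alpha>" for m
    using eig[OF translate_in_subshift[OF assms(1,3), of m]] by (simp add: shift_def algebra_simps)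
  show ?thesis
  proof (induction n rule: int_induct[where k = 0])
    case base
    show ?case by (simp flip: zero_real_mod_int_def)
  next
    case (step1 m)
    then show ?case using step[of m] by (simp add: add.assoc to_mod_int_add algebra_simps)
  next
    case (step2 m)
    have "g (\<lambda>i. x (i + (m - 1))) + to_mod_int \<alpha>
        = (g x + to_mod_int (of_int (m - 1) * \<alpha>)) + to_mod_int \<alpha>"
      using step2 step[of "m - 1"] by (simp add: add.assoc to_mod_int_add) (simp add: algebra_simps)
    then show ?case by (simp only: add_right_cancel)
  qed
qed

lemma rational_eigenfunction_finite_range:
  assumes "minimal_subshift X" "continuous_on X g" "\<alpha> \<in> \<rat>"
    and eig: "\<And>x. x \<in> X \<Longrightarrow> g (shift x) = g x + to_mod_int \<alpha>"
  shows "finite (g ` X)"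
proof (cases "X = {}")
  case False
  then obtain x where x: "x \<in> X" by blast
  have sub: "subshift X" and "closed X" and dense: "X \<subseteq> closure (shift_orbit x)"
    using assms(1) x by (auto simp: minimal_subshift_def subshift_def)
  define F where "F = (\<lambda>c. g x + c) ` range (\<lambda>n::int. to_mod_int (of_int n * \<alpha>))"
  have "finite F" unfolding F_def using finite_int_multiples_mod_int[OF assms(3)] by blast
  then have "closed (X \<inter> g -` F)"
    using continuous_on_closed_vimage[OF \<open>closed X\<close>] assms(2) finite_imp_closed
    by (metis Int_commute)
  moreover have "shift_orbit x \<subseteq> X \<inter> g -` F"
    using translate_in_subshift[OF sub x] eigenfunction_translate[where g = g, OF sub eig x]
    by (auto simp: shift_orbit_def F_def)
  ultimately have "X \<subseteq> X \<inter> g -` F" using dense closure_minimal by (meson subset_trans)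
  then show ?thesis using \<open>finite F\<close> by (meson finite_subset image_subset_iff_subset_vimage inf.boundedE)
qed simp

text \<open>A word of length \<open>2 * N + 1\<close> is placed on the window of coordinates from \<open>-N\<close> to \<open>N\<close>; any point
  of the subshift showing it there gives the same value of \<open>g\<close>.\<close>

lemma eigenfunction_imp_word_potential:
  fixes X :: "(int \<Rightarrow> 'a::{finite,discrete_topology}) set"
  assumes "minimal_subshift X" "\<alpha> \<in> eigenvalues X" "\<alpha> \<in> \<rat>"
  shows "\<exists>n h. word_potential X (to_mod_int \<alpha>) (Suc n) h"
proof -
  obtain g where g: "continuous_on X g" "\<And>x. x \<in> X \<Longrightarrow> g (shift x) = g x + to_mod_int \<alpha>"
    using assms(2) by (auto simp: eigenvalues_def)
  have sub: "subshift X" and "closed X"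
    using assms(1) by (auto simp: minimal_subshift_def subshift_def)
  obtain N where N: "\<And>x y. x \<in> X \<Longrightarrow> y \<in> X \<Longrightarrow> (\<And>i. \<bar>i\<bar> \<le> int N \<Longrightarrow> x i = y i) \<Longrightarrow> g x = g y"
    using finite_valued_depends_on_window[OF \<open>closed X\<close> g(1)
        rational_eigenfunction_finite_range[OF assms(1) g(1) assms(3) g(2)]]
    by blast
  define win where "win x = map (\<lambda>k. x (int k - int N)) [0..<Suc (2 * N)]" for x :: "int \<Rightarrow> 'a"
  define h where "h u = g (SOME x. x \<in> X \<and> win x = u)" for u
  have h: "h (win y) = g y" if "y \<in> X" for y
  proof -
    define z where "z = (SOME x. x \<in> X \<and> win x = win y)"
    have z: "z \<in> X" "win z = win y" unfolding z_def by (rule someI2[of _ y]; use that in simp)+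
    have "z i = y i" if "\<bar>i\<bar> \<le> int N" for i
    proof -
      define k where "k = nat (i + int N)"
      have "k < Suc (2 * N)" "int k - int N = i" using that by (auto simp: k_def)
      then show ?thesis
        using arg_cong[OF z(2), of "\<lambda>u. u ! k"] unfolding win_def by (simp del: upt_Suc)
    qed
    then have "g z = g y" using N z(1) \<open>y \<in> X\<close> by blast
    then show ?thesis by (simp add: h_def z_def)
  qed
  have "h (tl v) = h (butlast v) + to_mod_int \<alpha>"
    if v: "v \<in> language X" "length v = Suc (Suc (2 * N))" for v
  proof -
    obtain x i where x: "x \<in> X" "v = map (\<lambda>k. x (i + int k)) [0..<Suc (Suc (2 * N))]"
      using languageE[OF v(1)] unfolding v(2) .
    define y where "y = (\<lambda>j. x (j + (i + int N)))"
    have y: "y \<in> X" "shift y \<in> X"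
      using translate_in_subshift[OF sub x(1)] sub by (auto simp: y_def subshift_def)
    have "butlast v = win y"
      unfolding x(2) win_def y_def by (simp add: butlast_append algebra_simps)
    moreover have "tl v = win (shift y)"
      unfolding x(2) win_def y_def shift_def
      by (rule nth_equalityI) (simp_all add: nth_tl algebra_simps del: upt_Suc)
    ultimately show ?thesis using h[OF y(1)] h[OF y(2)] g(2)[OF y(1)] by simp
  qed
  then show ?thesis unfolding word_potential_def by blast
qed

section \<open>Even and odd letters\<close>

lemma even_letter_imp_rational_eigenvalue_integer:
  fixes X :: "(int \<Rightarrow> 'a::{finite,discrete_topology}) set"
  assumes "minimal_subshift X" and tree: "\<And>w. w \<in> language X \<Longrightarrow> w \<noteq> [] \<Longrightarrow> tree (extension_graph X w)"
    and "even_letter X a" "\<alpha> \<in> eigenvalues X" "\<alpha> \<in> \<rat>"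
  shows "\<alpha> \<in> \<int>"
proof -
  obtain n h where "word_potential X (to_mod_int \<alpha>) (Suc n) h"
    using eigenfunction_imp_word_potential[OF assms(1,4,5)] by blast
  then have "\<exists>h'. word_potential X (to_mod_int \<alpha>) 1 h'"
    by (rule word_potential_length_one[rotated]) (use tree in \<open>auto simp: tree_def\<close>)
  then have "to_mod_int \<alpha> = 0" using even_letter_word_potential_trivial[OF assms(3)] by blast
  then show ?thesis by (simp add: to_mod_int_eq_0_iff)
qed

lemma Ints_subset_eigenvalues: "\<int> \<subseteq> eigenvalues X"
  unfolding eigenvalues_def
  by (auto intro!: exI[of _ "\<lambda>_. 0"] simp: to_mod_int_eq_0_iff)

text \<open>The two copies of an odd letter lie in different components, and the left copy of \<open>x 0\<close> is
  adjacent to the right copy of \<open>x 1\<close>. Hence the left copies of \<open>x 0\<close> and \<open>x 1\<close> lie in different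
  components, and the component of the left copy of \<open>x 0\<close> changes with every shift.\<close>

lemma all_odd_imp_half_integer_eigenvalue:
  fixes X :: "(int \<Rightarrow> 'a::{finite,discrete_topology}) set"
  assumes letters: "\<And>a. [a] \<in> language X" and two: "card (components (extension_graph X [])) = 2"
    and odd: "\<And>a. odd_letter X a"
  shows "of_int k / 2 \<in> eigenvalues X"
proof -
  let ?G = "extension_graph X []"
  obtain C D where CD: "components ?G = {C, D}" using two by (metis card_2_iff)
  have vertex: "Inl a \<in> fst ?G" "Inr a \<in> fst ?G" for a
    using letters by (auto simp: extension_graph_def)
  have alternate: "Inl a \<in> C \<longleftrightarrow> Inr a \<notin> C" for a
    using odd[of a] component_cover[OF vertex(1)[of a]] component_cover[OF vertex(2)[of a]]
    unfolding even_letter_def CD by (metis insertE insertI1 singletonD insertI2)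
  define f :: "'a \<Rightarrow> real_mod_int" where
    "f a = (if Inl a \<in> C then 0 else to_mod_int (of_int k / 2))" for a
  have "continuous_on X (\<lambda>x. f (x 0))"
    by (rule continuous_on_compose2[of UNIV f X "\<lambda>x. x 0"])
       (auto intro: continuous_on_subset[OF continuous_on_product_coordinates])
  moreover have "f (shift x 0) = f (x 0) + to_mod_int (of_int k / 2)" if "x \<in> X" for x
  proof -
    have "[x 0, x 1] = map (\<lambda>k. x (0 + int k)) [0..<2]" by (simp add: upt_conv_Cons numeral_2_eq_2)
    then have "[x 0, x 1] \<in> language X" by (rule languageI[OF that])
    then have "{Inl (x 0), Inr (x 1)} \<in> snd ?G" by (auto simp: extension_graph_def)
    then have "Inl (x 0) \<in> C \<longleftrightarrow> Inr (x 1) \<in> C"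
      using component_edge[of C ?G] vertex CD by blast
    moreover have "to_mod_int (of_int k / 2) + to_mod_int (of_int k / 2) = 0"
      by (simp add: to_mod_int_add to_mod_int_eq_0_iff)
    ultimately show ?thesis using alternate[of "x 1"] by (simp add: f_def shift_def)
  qed
  ultimately show ?thesis unfolding eigenvalues_def by blast
qed

theorem theorem7p8:
  fixes X :: "(int \<Rightarrow> 'a::{finite,discrete_topology}) set"
    and \<theta> :: "'a \<Rightarrow> 'a"
  assumes "\<theta> \<circ> \<theta> = id"
    and "\<And>a. \<theta> a \<noteq> a"
    and "minimal_subshift X"
    and "\<And>a. [a] \<in> language X"
    and "specular \<theta> X"
  shows "(\<not> (\<forall>a. odd_letter X a) \<longrightarrow> eigenvalues X \<inter> \<rat> = \<int>) \<and>
         ((\<forall>a. odd_letter X a) \<longrightarrow> range (\<lambda>k::int. of_int k / 2) \<subseteq> eigenvalues X \<inter> \<rat>)"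
proof (intro conjI impI)
  assume "\<not> (\<forall>a. odd_letter X a)"
  then obtain a where "even_letter X a" by blast
  then have "eigenvalues X \<inter> \<rat> \<subseteq> \<int>"
    using even_letter_imp_rational_eigenvalue_integer[OF assms(3)] assms(5)
    by (auto simp: specular_def)
  moreover have "\<int> \<subseteq> eigenvalues X \<inter> \<rat>"
    using Ints_subset_eigenvalues Ints_subset_Rats by blast
  ultimately show "eigenvalues X \<inter> \<rat> = \<int>" by blast
next
  assume "\<forall>a. odd_letter X a"
  then have "of_int k / 2 \<in> eigenvalues X" for k
    using all_odd_imp_half_integer_eigenvalue[OF assms(4)] assms(5) by (auto simp: specular_def)
  then show "range (\<lambda>k::int. of_int k / 2) \<subseteq> eigenvalues X \<inter> \<rat>" by auto
qed

end
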